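(* Let $G=(V,E)$ be a finite connected undirected graph, let $\lambda>0$, and for each $v\in V$ let $f_v:\mathbb{R}\to\mathbb{R}$ be convex and differentiable. Let $x^\star\in\mathbb{R}$ be a minimizer over $x\in\mathbb{R}$ of $\sum_{v\in V}f_v(x)$ such that $$\forall A\subset V,\qquad \sum_{v\in A}f_v'(x^\star)\le\lambda\,\mathrm{Per}(A).$$ Then $x^\star 1_V$ is a minimizer over $x\in\mathbb{R}^V$ of $\sum_{v\in V}f_v(x(v))+\lambda\|x\|_{\mathrm{TV}}$.
   Context: $\mathbb{R}^V$ is the space of functions $V\to\mathbb{R}$; $1_V$ is the constant function $1$ on $V$ and $1_A$ is the indicator function of $A\subset V$. For $x\in\mathbb{R}^V$, $\|x\|_{\mathrm{TV}}=\sum_{\{v,w\}\in E}|x(v)-x(w)|$, and $\mathrm{Per}(A)=\|1_A\|_{\mathrm{TV}}$ for $A\subset V$. *)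

theory Defs
  imports "HOL-Analysis.Analysis" "Graph_Theory.Graph_Theory"
begin

text \<open>
  A finite simple undirected graph is a \<^locale>\<open>pair_graph\<close>: a finite, loop-free digraph whose arc
  set is symmetric.  Each undirected edge is thus a pair of opposite arcs, and the edge set \<open>E\<close> of
  unordered pairs is recovered as follows.
\<close>

definition edges :: "'v pair_pre_digraph \<Rightarrow> 'v set set" where
  "edges G = {{v, w} | v w. (v, w) \<in> parcs G}"

definition edge_var :: "('v \<Rightarrow> real) \<Rightarrow> 'v set \<Rightarrow> real" where
  "edge_var x e = (THE d. \<exists>v w. e = {v, w} \<and> d = \<bar>x v - x w\<bar>)"

lemma edge_var_pair [simp]: "edge_var x {v, w} = \<bar>x v - x w\<bar>"
  unfolding edge_var_def by (rule the_equality) (auto simp: doubleton_eq_iff)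

definition TV :: "'v pair_pre_digraph \<Rightarrow> ('v \<Rightarrow> real) \<Rightarrow> real" where
  "TV G x = (\<Sum>e\<in>edges G. edge_var x e)"

text \<open>
  The space of functions \<open>V \<rightarrow> \<real>\<close> is represented by the extensional functions on \<open>V\<close>, so that two
  elements are equal iff they agree on \<open>V\<close>.
\<close>

abbreviation RV :: "'v pair_pre_digraph \<Rightarrow> ('v \<Rightarrow> real) set" where
  "RV G \<equiv> pverts G \<rightarrow>\<^sub>E UNIV"

definition ind :: "'v pair_pre_digraph \<Rightarrow> 'v set \<Rightarrow> 'v \<Rightarrow> real" where
  "ind G A = restrict (indicator A) (pverts G)"

definition Per :: "'v pair_pre_digraph \<Rightarrow> 'v set \<Rightarrow> real" where
  "Per G A = TV G (ind G A)"

end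

theory Submission
  imports Defs
begin

text \<open>
  Convexity reduces the claim to the linear inequality
  \<open>\<Sum>v. c v * x v \<le> lam * TV x\<close> with \<open>c v = f\<^sub>v' x\<^sup>\<star>\<close> (applied to \<open>-x\<close>), where \<open>\<Sum>v. c v = 0\<close> since
  \<open>x\<^sup>\<star>\<close> is a minimizer. By the coarea formula, total variation is a positive combination of
  perimeters of superlevel sets, so it suffices to know the inequality for indicator functions,
  which is the hypothesis. The coarea formula enters as an induction on the number of values of
  \<open>x\<close> that peels off the topmost level set.
\<close>

lemma edgesE:
  assumes "pair_graph G" "e \<in> edges G"
  obtains v w where "e = {v, w}" "v \<in> pverts G" "w \<in> pverts G"
proof -
  interpret pair_graph G by fact
  show thesis
    using assms(2) that in_arcsD1 in_arcsD2 by (auto simp: edges_def)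
qed

lemma TV_nonneg: "TV G x \<ge> 0"
  unfolding TV_def by (rule sum_nonneg) (auto simp: edges_def)

lemma TV_uminus: "TV G (\<lambda>v. - x v) = TV G x"
  unfolding TV_def by (rule sum.cong) (auto simp: edges_def)

lemma TV_eq_0_if_constant:
  assumes "pair_graph G" "\<And>v. v \<in> pverts G \<Longrightarrow> x v = a"
  shows "TV G x = 0"
  unfolding TV_def by (rule sum.neutral) (auto elim!: edgesE[OF assms(1)] simp: assms(2))

text \<open>An edge leaving \<open>A\<close> already has its larger value in \<open>A\<close>, so
  raising \<open>A\<close> by \<open>d\<close> widens its gap by exactly \<open>d\<close> and
  absolute values add without cancellation; gaps of all other edges stay the same.\<close>

lemma TV_add_top_layer:
  assumes "pair_graph G" "d \<ge> 0"
    and top: "\<And>v w. v \<in> A \<Longrightarrow> w \<in> pverts G - A \<Longrightarrow> x w \<le> x v"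
  shows "TV G (\<lambda>v. x v + d * indicator A v) = TV G x + d * Per G A"
proof -
  have "edge_var (\<lambda>v. x v + d * indicator A v) e = edge_var x e + d * edge_var (ind G A) e"
    if "e \<in> edges G" for e
    using that
  proof (rule edgesE[OF assms(1)])
    fix v w assume e: "e = {v, w}" and vw: "v \<in> pverts G" "w \<in> pverts G"
    show ?thesis
      using vw top[of v w] top[of w v] \<open>d \<ge> 0\<close>
      by (auto simp: e ind_def indicator_def abs_if)
  qed
  then show ?thesis
    by (simp add: TV_def Per_def sum.distrib sum_distrib_left)
qed

text \<open>Peeling off top layers ends at a constant function, on which the left side vanishes by
  \<open>zero\<close>; each removed layer is paid for by \<open>per\<close>.\<close>

lemma sum_mult_le_TV:
  fixes c x :: "'v \<Rightarrow> real"
  assumes G: "pair_graph G"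
    and per: "\<And>A. A \<subseteq> pverts G \<Longrightarrow> sum c A \<le> lam * Per G A"
    and zero: "sum c (pverts G) = 0"
    and lam: "lam \<ge> 0"
  shows "(\<Sum>v\<in>pverts G. c v * x v) \<le> lam * TV G x"
proof (induction "card (x ` pverts G)" arbitrary: x rule: less_induct)
  case less
  interpret pair_graph G by (fact G)
  let ?V = "pverts G"
  show ?case
  proof (cases "\<exists>a. \<forall>v\<in>?V. x v = a")
    case True
    then obtain a where a: "\<And>v. v \<in> ?V \<Longrightarrow> x v = a" by blast
    have "(\<Sum>v\<in>?V. c v * x v) = sum c ?V * a"
      by (simp add: a sum_distrib_right)
    then show ?thesis
      using zero lam TV_nonneg[of G x] by simp
  next
    case False
    define M where "M = Max (x ` ?V)"
    define A where "A = {v \<in> ?V. x v = M}"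
    define m where "m = Max (x ` (?V - A))"
    \<comment> \<open>Lowering the top level set \<open>A\<close> to the second largest value
      \<open>m\<close> removes the value \<open>M\<close> and creates no new one, so the induction
      measure drops.\<close>
    define y where "y v = (if v \<in> A then m else x v)" for v
    have ne: "?V \<noteq> {}" and ne': "?V - A \<noteq> {}"
      using False unfolding A_def by blast+
    have "M \<in> x ` ?V"
      unfolding M_def using ne by (intro Max_in) auto
    then obtain u where u: "u \<in> ?V" "x u = M" by auto
    have "m \<in> x ` (?V - A)"
      unfolding m_def using ne' by (intro Max_in) auto
    then obtain w where w: "w \<in> ?V" "w \<notin> A" "x w = m" by auto
    have "x w \<le> M" unfolding M_def using w(1) by (intro Max_ge) auto
    with w have "m < M" by (auto simp: A_def)
    have le_m: "x v \<le> m" if "v \<in> ?V" "v \<notin> A" for v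
      unfolding m_def using that by (intro Max_ge) auto
    have x_eq: "x = (\<lambda>v. y v + (M - m) * indicator A v)"
      by (auto simp: y_def A_def fun_eq_iff)
    have "y ` ?V \<subseteq> x ` ?V - {M}"
      using w \<open>m < M\<close> by (auto simp: y_def A_def)
    then have "card (y ` ?V) < card (x ` ?V)"
      using \<open>M \<in> x ` ?V\<close> by (intro psubset_card_mono) auto
    from less[OF this] have IH: "(\<Sum>v\<in>?V. c v * y v) \<le> lam * TV G y" .
    have "A \<subseteq> ?V" by (auto simp: A_def)
    have c_ind: "(\<Sum>v\<in>?V. c v * indicator A v) = sum c A"
      using \<open>A \<subseteq> ?V\<close> by (subst sum_mult_indicator) (auto intro!: sum.cong)
    have "(\<Sum>v\<in>?V. c v * x v) = (\<Sum>v\<in>?V. c v * y v + (M - m) * (c v * indicator A v))"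
      by (subst x_eq) (simp add: algebra_simps)
    also have "\<dots> = (\<Sum>v\<in>?V. c v * y v) + (M - m) * sum c A"
      by (simp only: sum.distrib flip: sum_distrib_left c_ind)
    also have "\<dots>
        \<le> lam * TV G y + (M - m) * (lam * Per G A)"
      using IH per[OF \<open>A \<subseteq> ?V\<close>] \<open>m < M\<close> by (intro add_mono mult_left_mono) auto
    also have "\<dots> = lam * (TV G y + (M - m) * Per G A)"
      by (simp add: algebra_simps)
    \<comment> \<open>\<open>y\<close> equals \<open>m\<close> on \<open>A\<close> and is at most
      \<open>m\<close> elsewhere, so \<open>A\<close> is a top layer for \<open>y\<close>
      too.\<close>
    also have "TV G y + (M - m) * Per G A = TV G x"
      using \<open>m < M\<close> le_m by (subst x_eq, subst TV_add_top_layer[OF G]) (auto simp: y_def)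
    finally show ?thesis .
  qed
qed

lemma sum_deriv_eq_0_at_arg_min:
  fixes f :: "'a \<Rightarrow> real \<Rightarrow> real"
  assumes diff: "\<And>v. v \<in> V \<Longrightarrow> f v differentiable_on UNIV"
    and min: "is_arg_min (\<lambda>t. \<Sum>v\<in>V. f v t) (\<lambda>t. t \<in> UNIV) a"
  shows "(\<Sum>v\<in>V. deriv (f v) a) = 0"
proof (rule DERIV_local_min)
  show "((\<lambda>t. \<Sum>v\<in>V. f v t) has_real_derivative (\<Sum>v\<in>V. deriv (f v) a)) (at a)"
    using diff
    by (intro DERIV_sum)
      (auto simp: differentiable_on_def DERIV_deriv_iff_real_differentiable)
  \<comment> \<open>The minimum is global, so the radius 1 is an arbitrary choice.\<close>
  show "\<forall>t. \<bar>a - t\<bar> < 1 \<longrightarrow> (\<Sum>v\<in>V. f v a) \<le> (\<Sum>v\<in>V. f v t)"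
    using min by (auto simp: is_arg_min_def not_less)
qed simp

theorem corollary1:
  fixes G :: "'v pair_pre_digraph"
    and lam :: real
    and f :: "'v \<Rightarrow> real \<Rightarrow> real"
    and xs :: real
  assumes "pair_graph G" and "Digraph_Component.connected (with_proj G)"
    and "lam > 0"
    and "\<And>v. v \<in> pverts G \<Longrightarrow> convex_on UNIV (f v)"
    and "\<And>v. v \<in> pverts G \<Longrightarrow> f v differentiable_on UNIV"
    and "is_arg_min (\<lambda>t. \<Sum>v\<in>pverts G. f v t) (\<lambda>t. t \<in> UNIV) xs"
    and "\<forall>A. A \<subseteq> pverts G \<longrightarrow> (\<Sum>v\<in>A. deriv (f v) xs) \<le> lam * Per G A"
  shows "is_arg_min (\<lambda>x. (\<Sum>v\<in>pverts G. f v (x v)) + lam * TV G x)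
           (\<lambda>x. x \<in> RV G) (\<lambda>v\<in>pverts G. xs)"
proof -
  let ?V = "pverts G" and ?c = "\<lambda>v. deriv (f v) xs"
  have zero: "sum ?c ?V = 0"
    using assms(5,6) by (rule sum_deriv_eq_0_at_arg_min)
  \<comment> \<open>The left side is the objective at the constant function, whose total variation
    is 0.\<close>
  have "(\<Sum>v\<in>?V. f v xs) \<le> (\<Sum>v\<in>?V. f v (x v)) + lam * TV G x" for x
  proof -
    have tangent: "?c v * (x v - xs) \<le> f v (x v) - f v xs" if "v \<in> ?V" for v
    proof (rule convex_on_imp_above_tangent[OF assms(4)[OF that]])
      show "(f v has_real_derivative ?c v) (at xs within UNIV)"
        using assms(5)[OF that]
        by (auto simp: differentiable_on_def DERIV_deriv_iff_real_differentiable)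
    qed auto
    \<comment> \<open>The tangent bounds call for a lower bound on the sum of
      \<open>?c v * x v\<close>, hence the passage to \<open>-x\<close>, which has the same total
      variation.\<close>
    have "- (\<Sum>v\<in>?V. ?c v * x v) \<le> lam * TV G x"
      using sum_mult_le_TV[OF assms(1) _ zero, of lam "\<lambda>v. - x v"] assms(3,7)
      by (simp add: TV_uminus sum_negf)
    \<comment> \<open>Shifting by the constant \<open>xs\<close> is free because the derivatives sum
      to 0.\<close>
    moreover have "(\<Sum>v\<in>?V. ?c v * x v) = (\<Sum>v\<in>?V. ?c v * (x v - xs))"
      using zero by (simp add: right_diff_distrib sum_subtractf flip: sum_distrib_right)
    moreover have "\<dots> \<le> (\<Sum>v\<in>?V. f v (x v) - f v xs)"
      by (rule sum_mono) (rule tangent)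
    ultimately show ?thesis
      by (simp add: sum_subtractf)
  qed
  moreover have "TV G (\<lambda>v\<in>?V. xs) = 0"
    by (rule TV_eq_0_if_constant[OF assms(1)]) simp
  ultimately show ?thesis
    by (simp add: is_arg_min_def not_less)
qed

end
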